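(* Fix a leaf $k$ with parameters satisfying $\gamma_{jk}\ge\underline\gamma>0$ for all $j\in\mathcal J$, and price bounds $0\le\underline p_j<\bar p_j<\infty$. Let $\Delta_k=(\bar s_k-\underline s_k)/(M-1)$ be the spacing of an equally spaced grid with $M\ge2$ points on $[\underline s_k,\bar s_k]$ (endpoints included). For $s\in[\underline s_k,\bar s_k]$ let $s_m$ be the grid point nearest to $s$, write $\tilde{\bm p}_k(s):=\bm p_k^*(s_m)$, and set $\gamma_{\max}:=\max_{j\in\mathcal J}\gamma_{jk}$ and $\bar p_{\max}:=\max_{j\in\mathcal J}\bar p_j$. For all $s\in[\underline s_k,\bar s_k]$, the nearest-neighbor table satisfies: (i) (Price error) $\displaystyle\|\bm p_k^*(s)-\tilde{\bm p}_k(s)\|_\infty\le\frac{\bar p_{\max}}{8}\Delta_k=O(1/M)$. (ii) (Revenue loss) $$R_k\bigl(\bm p_k^*(s),s\bigr)-R_k\bigl(\tilde{\bm p}_k(s),s\bigr)\le\frac{3\gamma_{\max}(2+\gamma_{\max}\bar p_{\max})\bar p_{\max}^2}{128}\Delta_k^2=O(1/M^2).$$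
   Context: $\mathcal J$ is a finite nonempty set of products. Leaf $k$ has multinomial logit parameters $(\bm\alpha_k,\bm\beta_k,\bm\gamma_k)$. For scalar index $s\in\mathbb R$ and prices $\bm p$, with $A_{jk}(s)=\exp\{\alpha_{jk}+s\}$, $$\pi_{jk}(\bm p,s)=\frac{A_{jk}(s)e^{-\gamma_{jk}p_j}}{1+\sum_{r\in\mathcal J}A_{rk}(s)e^{-\gamma_{rk}p_r}},\qquad R_k(\bm p,s)=\sum_{j\in\mathcal J}p_j\pi_{jk}(\bm p,s).$$ $\bm p_k^*(s)$ denotes the (unique) maximizer of $R_k(\cdot,s)$ over $\mathcal P=\prod_{j\in\mathcal J}[\underline p_j,\bar p_j]$. The scalar index of a feature vector $\bm x$ is $\bm\beta_k^\top\bm x$; $\underline s_k$ and $\bar s_k$ are the (finite) infimum and supremum of $\bm\beta_k^\top\bm x$ over the feature vectors $\bm x$ in the compact feature domain that are routed to leaf $k$. $O(\cdot)$ is as $M\to\infty$ with the leaf and bounds fixed. *)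

theory Defs
  imports "HOL-Analysis.Analysis" "HOL-Library.Landau_Symbols"
begin

text \<open>
  The finite nonempty product set is the finite index type \<open>'j\<close>; price vectors, price bounds
  and the leaf parameters \<open>\<alpha>\<close>, \<open>\<gamma>\<close> are elements of \<open>real ^ 'j\<close>. The parameters passed to the
  following functions are those of a single leaf.
\<close>

definition attraction :: "real ^ 'j \<Rightarrow> real \<Rightarrow> 'j \<Rightarrow> real" where
  "attraction \<alpha> s j = exp (\<alpha> $ j + s)"

definition choice_prob ::
  "real ^ 'j \<Rightarrow> real ^ 'j \<Rightarrow> real ^ 'j \<Rightarrow> real \<Rightarrow> 'j::finite \<Rightarrow> real" where
  "choice_prob \<alpha> \<gamma> p s j =
     attraction \<alpha> s j * exp (- (\<gamma> $ j * p $ j)) /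
     (1 + (\<Sum>r\<in>UNIV. attraction \<alpha> s r * exp (- (\<gamma> $ r * p $ r))))"

definition revenue ::
  "real ^ 'j::finite \<Rightarrow> real ^ 'j \<Rightarrow> real ^ 'j \<Rightarrow> real \<Rightarrow> real" where
  "revenue \<alpha> \<gamma> p s = (\<Sum>j\<in>UNIV. p $ j * choice_prob \<alpha> \<gamma> p s j)"

text \<open>
  On \<open>real ^ 'j\<close>, \<open>cbox plo phi\<close> is the product of the intervals \<open>{plo $ j..phi $ j}\<close>.
  The description operator is legitimate when \<open>\<gamma>\<close> is positive: the partial derivative of the
  revenue in \<open>p $ j\<close> is \<open>\<pi> j * (1 - \<gamma> $ j * (p $ j - R))\<close>, so every maximizer over the box has
  coordinates equal to \<open>1 / \<gamma> $ j + R\<close> clipped to the interval, where \<open>R\<close> is the maximal value.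
\<close>

definition opt_price ::
  "real ^ 'j::finite \<Rightarrow> real ^ 'j \<Rightarrow> real ^ 'j \<Rightarrow> real ^ 'j \<Rightarrow> real \<Rightarrow> real ^ 'j" where
  "opt_price \<alpha> \<gamma> plo phi s =
     (THE p. is_arg_max (\<lambda>q. revenue \<alpha> \<gamma> q s) (\<lambda>q. q \<in> cbox plo phi) p)"

text \<open>
  \<open>route\<close> is the leaf assignment on the feature domain \<open>X\<close>; \<open>\<beta> k\<close> is the index coefficient of
  leaf \<open>k\<close>.
\<close>

definition routed_to :: "'x set \<Rightarrow> ('x \<Rightarrow> 'l) \<Rightarrow> 'l \<Rightarrow> 'x set" where
  "routed_to X route k = {x \<in> X. route x = k}"

definition index_inf ::
  "('l \<Rightarrow> real ^ 'd::finite) \<Rightarrow> (real ^ 'd) set \<Rightarrow> (real ^ 'd \<Rightarrow> 'l) \<Rightarrow> 'l \<Rightarrow> real" where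
  "index_inf \<beta> X route k = (INF x\<in>routed_to X route k. \<beta> k \<bullet> x)"

definition index_sup ::
  "('l \<Rightarrow> real ^ 'd::finite) \<Rightarrow> (real ^ 'd) set \<Rightarrow> (real ^ 'd \<Rightarrow> 'l) \<Rightarrow> 'l \<Rightarrow> real" where
  "index_sup \<beta> X route k = (SUP x\<in>routed_to X route k. \<beta> k \<bullet> x)"

definition grid_spacing :: "real \<Rightarrow> real \<Rightarrow> nat \<Rightarrow> real" where
  "grid_spacing lo hi M = (hi - lo) / (real M - 1)"

text \<open>The \<open>M\<close> grid points are indexed by \<open>m < M\<close>, so \<open>m = 0\<close> and \<open>m = M - 1\<close> are the endpoints.\<close>

definition grid_point :: "real \<Rightarrow> real \<Rightarrow> nat \<Rightarrow> nat \<Rightarrow> real" where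
  "grid_point lo hi M m = lo + real m * grid_spacing lo hi M"

text \<open>A relation rather than a function: at a midpoint both neighbours qualify.\<close>

definition nearest_index :: "real \<Rightarrow> real \<Rightarrow> nat \<Rightarrow> real \<Rightarrow> nat \<Rightarrow> bool" where
  "nearest_index lo hi M s m \<longleftrightarrow>
     is_arg_min (\<lambda>i. \<bar>s - grid_point lo hi M i\<bar>) (\<lambda>i. i < M) m"

end

theory Submission
  imports Defs
begin

text \<open>
  For a fixed index, the revenue is a ratio \<open>N / (1 + W)\<close>, where \<open>W\<close> is the sum of the weights
  \<open>w\<^sub>j = A\<^sub>j exp (- \<gamma>\<^sub>j p\<^sub>j)\<close> and \<open>N\<close> is the sum of \<open>p\<^sub>j w\<^sub>j\<close>. For every level \<open>l\<close>, the identity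
  \<open>(l - R(p)) (1 + W) = l - (\<Sum>j. (p\<^sub>j - l) w\<^sub>j)\<close>,
  separates the products (\<open>revenue_gap\<close>). Each weighted margin \<open>(x - l) w\<^sub>j(x)\<close> increases strictly
  up to \<open>1 / \<gamma>\<^sub>j + l\<close> and decreases strictly afterwards. Taking for \<open>l\<close> the maximal revenue \<open>R*\<close>
  shows that the maximizer is unique and that its coordinates are \<open>1 / \<gamma>\<^sub>j + R*\<close> clipped to the
  price intervals (\<open>maximizer_eq_clip\<close>). All dependence of the optimal prices on the index thus goes
  through the single number \<open>R*\<close>, and clipping is nonexpansive.

  For the price error it remains to see how fast \<open>R*\<close> moves. With fixed prices, the derivative of
  the revenue in the index is \<open>R\<close> times the no-purchase probability; as \<open>R\<close> is at most the largest
  price times the purchase probability \<open>\<Pi>\<close>, it is at most that price times \<open>\<Pi> (1 - \<Pi>) \<le> 1 / 4\<close>. A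
  maximum of functions with a common Lipschitz constant has the same constant, and a nearest grid
  point is at distance at most half the spacing, which gives the factor \<open>1 / 8\<close>.

  For the revenue loss, put \<open>l = R*\<close> in the identity again: the loss is a sum of differences of
  weighted margins, divided by \<open>1 + W\<close>. The derivative of a margin is its weight times \<open>\<gamma>\<^sub>j\<close> times
  the distance to the peak. Between an optimal price and a tabulated price this distance is at most
  the bound \<open>d\<close> on the change of \<open>R*\<close>, even when clipping is active, so the mean value
  theorem gives a loss of at most \<open>g exp (g d) d\<^sup>2\<close>, with \<open>g\<close> the largest \<open>\<gamma>\<^sub>j\<close> (\<open>revenue_loss\<close>).
  For \<open>g d \<le> 1\<close> the exponential is at most \<open>3\<close>; for \<open>g d > 1\<close> the loss is at most the largest
  price, which the quadratic bound then exceeds (\<open>revenue_loss_quadratic\<close>).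
\<close>

section \<open>The weighted margin of one product\<close>

definition clip :: "real \<Rightarrow> real \<Rightarrow> real \<Rightarrow> real" where
  "clip lo hi c = max lo (min hi c)"

lemma clip_nonexpansive: "\<bar>clip lo hi c - clip lo hi c'\<bar> \<le> \<bar>c - c'\<bar>"
  unfolding clip_def by (auto simp: max_def min_def)

lemma clip_mem: "lo \<le> hi \<Longrightarrow> clip lo hi c \<in> {lo..hi}"
  unfolding clip_def by auto

text \<open>
  Clipping keeps order, and wherever two clipped values differ, the interval between them lies
  between the unclipped ones. This is what makes second-order estimates survive at active bounds,
  where the derivative at the optimum need not vanish.
\<close>

lemma between_clips:
  assumes "min (clip lo hi c) (clip lo hi c') < x" "x < max (clip lo hi c) (clip lo hi c')"
  shows "\<bar>x - c\<bar> \<le> \<bar>c - c'\<bar>"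
  using assms unfolding clip_def by (auto simp: max_def min_def split: if_splits)

definition weighted_margin :: "real \<Rightarrow> real \<Rightarrow> real \<Rightarrow> real \<Rightarrow> real" where
  "weighted_margin K g l x = (x - l) * (K * exp (- (g * x)))"

lemma weighted_margin_deriv:
  assumes "g > 0"
  shows "(weighted_margin K g l has_real_derivative
           K * exp (- (g * x)) * g * (1 / g + l - x)) (at x)"
  unfolding weighted_margin_def[abs_def] using assms
  by (auto intro!: derivative_eq_intros simp: field_simps)

lemma weighted_margin_less_clip:
  assumes "g > 0" "K > 0" "x \<in> {lo..hi}" "x \<noteq> clip lo hi (1 / g + l)"
  shows "weighted_margin K g l x < weighted_margin K g l (clip lo hi (1 / g + l))"
proof (cases "x < clip lo hi (1 / g + l)")
  case True
  let ?y = "clip lo hi (1 / g + l)"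
  have "?y \<le> 1 / g + l"
    using True assms(3) unfolding clip_def by (auto simp: max_def min_def split: if_splits)
  moreover obtain z where z: "x < z" "z < ?y"
      "weighted_margin K g l ?y - weighted_margin K g l x
         = (?y - x) * (K * exp (- (g * z)) * g * (1 / g + l - z))"
    using MVT2[OF True weighted_margin_deriv[OF assms(1)]] by metis
  ultimately have "0 < (?y - x) * (K * exp (- (g * z)) * g * (1 / g + l - z))"
    using True assms(1,2) by (intro mult_pos_pos) auto
  then show ?thesis using z(3) by linarith
next
  case False
  let ?y = "clip lo hi (1 / g + l)"
  have less: "?y < x" using False assms(4) by linarith
  then have "1 / g + l \<le> ?y"
    using assms(3) unfolding clip_def by (auto simp: max_def min_def split: if_splits)
  moreover obtain z where z: "?y < z" "z < x"
      "weighted_margin K g l x - weighted_margin K g l ?y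
         = (x - ?y) * (K * exp (- (g * z)) * g * (1 / g + l - z))"
    using MVT2[OF less weighted_margin_deriv[OF assms(1)]] by metis
  ultimately have "(x - ?y) * (K * exp (- (g * z)) * g * (1 / g + l - z)) < 0"
    using less assms(1,2) by (intro mult_pos_neg mult_pos_pos) auto
  then show ?thesis using z(3) by linarith
qed

text \<open>
  With \<open>l\<close> the optimal revenue at the true index and \<open>l'\<close> the one at the grid point, this is the
  loss that a single product causes. Both the length of the interval and the derivative on it are
  of order \<open>d\<close>, which makes the bound quadratic. The bound is stated relative to the
  weight at the tabulated price \<open>q\<close>, because the sum over the products is later divided by one plus
  the total of these weights; moving the weight from the intermediate point to \<open>q\<close> costs the factor
  \<open>exp (g * d)\<close>.
\<close>

lemma weighted_margin_loss:
  fixes d lo hi :: real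
  assumes "g > 0" "K > 0" "\<bar>l - l'\<bar> \<le> d"
  defines "p \<equiv> clip lo hi (1 / g + l)" and "q \<equiv> clip lo hi (1 / g + l')"
  shows "weighted_margin K g l p - weighted_margin K g l q
           \<le> g * exp (g * d) * d\<^sup>2 * (K * exp (- (g * q)))"
proof (cases "p = q")
  case True
  then show ?thesis using assms(1,2) by simp
next
  case False
  let ?D = "\<lambda>z. K * exp (- (g * z)) * g * (1 / g + l - z)"
  have "\<exists>z. min p q < z \<and> z < max p q \<and>
          weighted_margin K g l p - weighted_margin K g l q = (p - q) * ?D z"
  proof (cases "p < q")
    case True
    then obtain z where "p < z" "z < q"
        "weighted_margin K g l q - weighted_margin K g l p = (q - p) * ?D z"
      using MVT2[OF True weighted_margin_deriv[OF assms(1)]] by metis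
    then show ?thesis using True by (intro exI[of _ z]) (auto simp: algebra_simps)
  next
    case False
    then have less: "q < p" using \<open>p \<noteq> q\<close> by simp
    then obtain z where "q < z" "z < p"
        "weighted_margin K g l p - weighted_margin K g l q = (p - q) * ?D z"
      using MVT2[OF less weighted_margin_deriv[OF assms(1)]] by metis
    then show ?thesis using less by (intro exI[of _ z]) auto
  qed
  then obtain z where z: "min p q < z" "z < max p q"
      "weighted_margin K g l p - weighted_margin K g l q = (p - q) * ?D z"
    by blast
  have pq: "\<bar>p - q\<bar> \<le> d"
    using clip_nonexpansive[of lo hi "1 / g + l" "1 / g + l'"] assms(3)
    unfolding p_def q_def by simp
  have zc: "\<bar>1 / g + l - z\<bar> \<le> d"
    using between_clips[of lo hi "1 / g + l" "1 / g + l'" z] z(1,2) assms(3)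
    unfolding p_def q_def by (simp add: abs_minus_commute)
  have "g * (q - z) \<le> g * d"
    using z(1,2) pq assms(1) by (intro mult_left_mono) auto
  then have "exp (- (g * z)) \<le> exp (g * d) * exp (- (g * q))"
    by (simp add: exp_add[symmetric] algebra_simps)
  then have "K * exp (- (g * z)) * g \<le> K * (exp (g * d) * exp (- (g * q))) * g"
    using assms(1,2) by simp
  then have "\<bar>?D z\<bar> \<le> K * (exp (g * d) * exp (- (g * q))) * g * d"
    unfolding abs_mult using zc assms(1,2) by (intro mult_mono) auto
  then have "\<bar>p - q\<bar> * \<bar>?D z\<bar> \<le> d * (K * (exp (g * d) * exp (- (g * q))) * g * d)"
    using pq by (intro mult_mono) auto
  then have "(p - q) * ?D z \<le> d * (K * (exp (g * d) * exp (- (g * q))) * g * d)"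
    unfolding abs_mult[symmetric] by linarith
  then show ?thesis using z(3) by (simp add: power2_eq_square algebra_simps)
qed

section \<open>Revenue as a ratio, and the fixed-point form of the optimal prices\<close>

definition weight :: "real ^ 'j \<Rightarrow> real ^ 'j \<Rightarrow> real \<Rightarrow> 'j \<Rightarrow> real \<Rightarrow> real" where
  "weight \<alpha> \<gamma> s j x = attraction \<alpha> s j * exp (- (\<gamma> $ j * x))"

lemma weight_pos: "weight \<alpha> \<gamma> s j x > 0"
  by (simp add: weight_def attraction_def)

lemma total_weight_nonneg: "(\<Sum>j\<in>UNIV. weight \<alpha> \<gamma> s j (p $ j)) \<ge> 0"
  by (intro sum_nonneg less_imp_le weight_pos)

text \<open>
  The index enters all weights through one common factor, so for fixed prices the revenue is an
  elementary function of the index.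
\<close>

lemma weight_shift: "weight \<alpha> \<gamma> s j x = exp s * weight \<alpha> \<gamma> 0 j x"
  by (simp add: weight_def attraction_def exp_add)

lemma revenue_ratio:
  "revenue \<alpha> \<gamma> p s = (\<Sum>j\<in>UNIV. p $ j * weight \<alpha> \<gamma> s j (p $ j)) /
                     (1 + (\<Sum>j\<in>UNIV. weight \<alpha> \<gamma> s j (p $ j)))"
  by (simp add: revenue_def choice_prob_def weight_def sum_divide_distrib)

text \<open>
  This identity replaces a fractional objective by one that is separable in the products, exactly
  and for every level \<open>l\<close>.
\<close>

lemma revenue_gap:
  "(l - revenue \<alpha> \<gamma> p s) * (1 + (\<Sum>j\<in>UNIV. weight \<alpha> \<gamma> s j (p $ j)))
     = l - (\<Sum>j\<in>UNIV. weighted_margin (attraction \<alpha> s j) (\<gamma> $ j) l (p $ j))"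
proof -
  let ?W = "\<Sum>j\<in>UNIV. weight \<alpha> \<gamma> s j (p $ j)"
  let ?N = "\<Sum>j\<in>UNIV. p $ j * weight \<alpha> \<gamma> s j (p $ j)"
  have "1 + ?W \<noteq> 0" using total_weight_nonneg[of \<alpha> \<gamma> s p] by linarith
  then have "revenue \<alpha> \<gamma> p s * (1 + ?W) = ?N" by (simp add: revenue_ratio)
  moreover have "(\<Sum>j\<in>UNIV. weighted_margin (attraction \<alpha> s j) (\<gamma> $ j) l (p $ j)) = ?N - l * ?W"
    by (simp add: weighted_margin_def weight_def left_diff_distrib sum_subtractf sum_distrib_left)
  ultimately show ?thesis by (simp add: left_diff_distrib distrib_left)
qed

text \<open>
  At the level of the maximal revenue, the maximizer also maximizes the sum of the weighted margins:
  if some coordinate were not at the constrained peak of its margin, moving this coordinate alone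
  would raise the sum above the level, and hence the revenue above its maximum.
\<close>

lemma maximizer_eq_clip:
  fixes \<alpha> \<gamma> plo phi p :: "real ^ 'j::finite"
  assumes "\<And>j. \<gamma> $ j > 0" and p: "p \<in> cbox plo phi"
    and max: "\<And>q. q \<in> cbox plo phi \<Longrightarrow> revenue \<alpha> \<gamma> q s \<le> revenue \<alpha> \<gamma> p s"
  shows "p $ j = clip (plo $ j) (phi $ j) (1 / \<gamma> $ j + revenue \<alpha> \<gamma> p s)"
proof (rule ccontr)
  let ?l = "revenue \<alpha> \<gamma> p s"
  let ?g = "\<lambda>i. weighted_margin (attraction \<alpha> s i) (\<gamma> $ i) ?l"
  define c where "c = clip (plo $ j) (phi $ j) (1 / \<gamma> $ j + ?l)"
  define q where "q = (\<chi> i. if i = j then c else p $ i)"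
  assume "p $ j \<noteq> clip (plo $ j) (phi $ j) (1 / \<gamma> $ j + ?l)"
  moreover have pj: "p $ j \<in> {plo $ j..phi $ j}" using p by (auto simp: mem_box_cart)
  ultimately have less: "?g j (p $ j) < ?g j c"
    unfolding c_def using assms(1)
    by (intro weighted_margin_less_clip) (auto simp: attraction_def)
  have "c \<in> {plo $ j..phi $ j}" unfolding c_def using pj by (intro clip_mem) auto
  then have "q \<in> cbox plo phi" using p by (auto simp: mem_box_cart q_def)
  then have "(?l - revenue \<alpha> \<gamma> q s) * (1 + (\<Sum>i\<in>UNIV. weight \<alpha> \<gamma> s i (q $ i))) \<ge> 0"
    using max[of q] total_weight_nonneg[of \<alpha> \<gamma> s q] by simp
  then have "(\<Sum>i\<in>UNIV. ?g i (q $ i)) \<le> ?l" using revenue_gap[of ?l \<alpha> \<gamma> q s] by linarith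
  moreover have "(\<Sum>i\<in>UNIV. ?g i (p $ i)) = ?l" using revenue_gap[of ?l \<alpha> \<gamma> p s] by simp
  moreover have "(\<Sum>i\<in>UNIV. ?g i (p $ i)) < (\<Sum>i\<in>UNIV. ?g i (q $ i))"
    using less by (intro sum_strict_mono_ex1) (auto simp: q_def)
  ultimately show False by linarith
qed

lemma continuous_on_revenue: "continuous_on S (\<lambda>p. revenue \<alpha> \<gamma> p s)"
proof -
  have "1 + (\<Sum>j\<in>UNIV. weight \<alpha> \<gamma> s j (p $ j)) \<noteq> 0" for p
    using total_weight_nonneg[of \<alpha> \<gamma> s p] by linarith
  then show ?thesis
    unfolding revenue_ratio by (auto intro!: continuous_intros simp: weight_def)
qed

text \<open>
  Two maximizers have the same revenue, and the clipping formula determines a maximizer from its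
  revenue alone, so the description in the definition denotes.
\<close>

lemma opt_price_is_maximizer:
  fixes \<alpha> \<gamma> plo phi :: "real ^ 'j::finite"
  assumes pos: "\<And>j. \<gamma> $ j > 0" and le: "\<And>j. plo $ j \<le> phi $ j"
  shows opt_price_mem: "opt_price \<alpha> \<gamma> plo phi s \<in> cbox plo phi"
    and opt_price_max:
      "q \<in> cbox plo phi \<Longrightarrow> revenue \<alpha> \<gamma> q s \<le> revenue \<alpha> \<gamma> (opt_price \<alpha> \<gamma> plo phi s) s"
proof -
  let ?M = "is_arg_max (\<lambda>q. revenue \<alpha> \<gamma> q s) (\<lambda>q. q \<in> cbox plo phi)"
  have M: "?M p \<longleftrightarrow> p \<in> cbox plo phi \<and>
      (\<forall>q \<in> cbox plo phi. revenue \<alpha> \<gamma> q s \<le> revenue \<alpha> \<gamma> p s)" for p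
    by (auto simp: is_arg_max_linorder)
  have "plo \<in> cbox plo phi" using le by (auto simp: mem_box_cart)
  then obtain p where p: "?M p"
    using continuous_attains_sup[OF compact_cbox, of plo phi "\<lambda>q. revenue \<alpha> \<gamma> q s"]
      continuous_on_revenue M by blast
  have "q = p" if "?M q" for q
  proof -
    have "revenue \<alpha> \<gamma> q s = revenue \<alpha> \<gamma> p s" using p that M by (meson order_antisym)
    then show ?thesis
      using maximizer_eq_clip[of \<gamma> p plo phi \<alpha> s] maximizer_eq_clip[of \<gamma> q plo phi \<alpha> s]
        p that M pos by (auto simp: vec_eq_iff)
  qed
  with p have "?M (opt_price \<alpha> \<gamma> plo phi s)" unfolding opt_price_def by (rule theI)
  then show "opt_price \<alpha> \<gamma> plo phi s \<in> cbox plo phi"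
    and "q \<in> cbox plo phi \<Longrightarrow> revenue \<alpha> \<gamma> q s \<le> revenue \<alpha> \<gamma> (opt_price \<alpha> \<gamma> plo phi s) s"
    using M by auto
qed

lemma opt_price_eq_clip:
  fixes \<alpha> \<gamma> plo phi :: "real ^ 'j::finite"
  assumes "\<And>j. \<gamma> $ j > 0" "\<And>j. plo $ j \<le> phi $ j"
  shows "opt_price \<alpha> \<gamma> plo phi s $ j = clip (plo $ j) (phi $ j)
           (1 / \<gamma> $ j + revenue \<alpha> \<gamma> (opt_price \<alpha> \<gamma> plo phi s) s)"
  using assms by (intro maximizer_eq_clip opt_price_mem opt_price_max)

section \<open>Sensitivity of the optimal revenue and the optimal prices to the index\<close>

lemma price_sum_bounds:
  fixes p :: "real ^ 'j::finite"
  assumes "\<And>j. 0 \<le> p $ j" "\<And>j. p $ j \<le> P"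
  shows "0 \<le> (\<Sum>j\<in>UNIV. p $ j * weight \<alpha> \<gamma> s j (p $ j))"
    and "(\<Sum>j\<in>UNIV. p $ j * weight \<alpha> \<gamma> s j (p $ j))
           \<le> P * (\<Sum>j\<in>UNIV. weight \<alpha> \<gamma> s j (p $ j))"
  using assms weight_pos[of \<alpha> \<gamma> s]
  by (auto intro!: sum_nonneg sum_mono mult_right_mono simp: sum_distrib_left less_imp_le)

lemma revenue_bounds:
  fixes p :: "real ^ 'j::finite"
  assumes "\<And>j. 0 \<le> p $ j" "\<And>j. p $ j \<le> P"
  shows "0 \<le> revenue \<alpha> \<gamma> p s" "revenue \<alpha> \<gamma> p s \<le> P"
proof -
  have "0 \<le> P" using assms order_trans by blast
  then show "0 \<le> revenue \<alpha> \<gamma> p s" "revenue \<alpha> \<gamma> p s \<le> P"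
    using price_sum_bounds[of p P \<alpha> \<gamma> s, OF assms] total_weight_nonneg[of \<alpha> \<gamma> s p]
    by (auto simp: revenue_ratio divide_le_eq distrib_left)
qed

text \<open>
  The derivative is \<open>e N / (1 + e W)\<^sup>2\<close> with \<open>e\<close> the exponential of the index. Since \<open>N \<le> P W\<close>, the
  constant comes from \<open>4 e W \<le> (1 + e W)\<^sup>2\<close>.
\<close>

lemma revenue_lipschitz_index:
  fixes p :: "real ^ 'j::finite"
  assumes "\<And>j. 0 \<le> p $ j" "\<And>j. p $ j \<le> P"
  shows "\<bar>revenue \<alpha> \<gamma> p s - revenue \<alpha> \<gamma> p t\<bar> \<le> P / 4 * \<bar>s - t\<bar>"
proof -
  define N where "N = (\<Sum>j\<in>UNIV. p $ j * weight \<alpha> \<gamma> 0 j (p $ j))"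
  define W where "W = (\<Sum>j\<in>UNIV. weight \<alpha> \<gamma> 0 j (p $ j))"
  have NW: "0 \<le> N" "N \<le> P * W" "0 \<le> W"
    using price_sum_bounds[of p P \<alpha> \<gamma> 0, OF assms] total_weight_nonneg[of \<alpha> \<gamma> 0 p]
    by (auto simp: N_def W_def)
  have P: "0 \<le> P" using assms order_trans by blast
  have rev: "revenue \<alpha> \<gamma> p u = exp u * N / (1 + exp u * W)" for u
    unfolding revenue_ratio N_def W_def
    by (subst (1 2) weight_shift) (simp add: sum_distrib_left mult.left_commute)
  have den: "1 + exp u * W > 0" for u using NW(3) by (simp add: add_pos_nonneg)
  have deriv: "(revenue \<alpha> \<gamma> p has_real_derivative exp u * N / (1 + exp u * W)\<^sup>2)
      (at u within UNIV)" for u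
    unfolding rev[abs_def] using den[of u]
    by (auto intro!: derivative_eq_intros simp: field_simps power2_eq_square)
  have "exp u * N / (1 + exp u * W)\<^sup>2 \<le> P / 4" for u
  proof -
    have "4 * (exp u * N) \<le> 4 * (exp u * (P * W))" using NW(2) by simp
    also have "\<dots> = P * (4 * (exp u * W))" by simp
    also have "\<dots> \<le> P * (1 + exp u * W)\<^sup>2"
      using zero_le_power2[of "1 - exp u * W"] P
      by (intro mult_left_mono) (auto simp: power2_eq_square algebra_simps)
    finally show ?thesis using den[of u] by (simp add: field_simps)
  qed
  moreover have "0 \<le> exp u * N / (1 + exp u * W)\<^sup>2" for u using NW(1) by simp
  ultimately have "norm (exp u * N / (1 + exp u * W)\<^sup>2) \<le> P / 4" for u
    unfolding real_norm_def by (metis abs_of_nonneg)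
  from field_differentiable_bound[OF convex_UNIV deriv this UNIV_I UNIV_I, of s t]
  show ?thesis by simp
qed

context
  fixes \<alpha> \<gamma> plo phi :: "real ^ 'j::finite" and P :: real
  assumes pos: "\<And>j. \<gamma> $ j > 0"
    and lo: "\<And>j. 0 \<le> plo $ j" and le: "\<And>j. plo $ j \<le> phi $ j" and hi: "\<And>j. phi $ j \<le> P"
begin

abbreviation (input) "opt \<equiv> opt_price \<alpha> \<gamma> plo phi"
abbreviation (input) "opt_revenue s \<equiv> revenue \<alpha> \<gamma> (opt s) s"

lemma opt_coordinates: "0 \<le> opt s $ j" "opt s $ j \<le> P"
proof -
  have "plo $ j \<le> opt s $ j" "opt s $ j \<le> phi $ j"
    using opt_price_mem[of \<gamma> plo phi \<alpha> s] pos le by (auto simp: mem_box_cart)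
  then show "0 \<le> opt s $ j" "opt s $ j \<le> P" using lo[of j] hi[of j] by linarith+
qed

text \<open>
  Keeping the prices optimal for \<open>u\<close> when the index moves to \<open>v\<close> yields at most the optimum at \<open>v\<close>,
  so the Lipschitz bound for fixed prices carries over to the maximum.
\<close>

lemma opt_revenue_lipschitz: "\<bar>opt_revenue s - opt_revenue t\<bar> \<le> P / 4 * \<bar>s - t\<bar>"
proof -
  have "opt_revenue u - opt_revenue v \<le> P / 4 * \<bar>u - v\<bar>" for u v
  proof -
    have "revenue \<alpha> \<gamma> (opt u) v \<le> opt_revenue v"
      using pos le by (intro opt_price_max opt_price_mem)
    then show ?thesis
      using revenue_lipschitz_index[OF opt_coordinates, of \<alpha> \<gamma> u u v] by linarith
  qed
  from this[of s t] this[of t s] show ?thesis by (intro abs_leI) (auto simp: abs_minus_commute)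
qed

lemma opt_price_lipschitz: "infnorm (opt s - opt t) \<le> P / 4 * \<bar>s - t\<bar>"
proof -
  have "\<bar>(opt s - opt t) $ j\<bar> \<le> P / 4 * \<bar>s - t\<bar>" for j
    using clip_nonexpansive[of "plo $ j" "phi $ j" "1 / \<gamma> $ j + opt_revenue s"
        "1 / \<gamma> $ j + opt_revenue t"] opt_revenue_lipschitz[of s t]
      opt_price_eq_clip[of \<gamma> plo phi \<alpha> _ j] pos le by simp
  then show ?thesis unfolding infnorm_cart by (intro cSup_least) auto
qed

text \<open>
  The losses of the products add up to a multiple of the total weight \<open>W\<close> at the tabulated prices.
  The factor \<open>1 + W\<close> in \<open>revenue_gap\<close> absorbs it, so the bound depends neither on the number of
  products nor on their attractions.
\<close>

lemma revenue_loss: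
  assumes g: "\<And>j. \<gamma> $ j \<le> g" and d: "P / 4 * \<bar>s - t\<bar> \<le> d"
  shows "opt_revenue s - revenue \<alpha> \<gamma> (opt t) s \<le> g * exp (g * d) * d\<^sup>2"
proof -
  let ?m = "\<lambda>j. weighted_margin (attraction \<alpha> s j) (\<gamma> $ j) (opt_revenue s)"
  let ?w = "\<lambda>j. weight \<alpha> \<gamma> s j (opt t $ j)"
  let ?W = "\<Sum>j\<in>UNIV. ?w j"
  let ?C = "g * exp (g * d) * d\<^sup>2"
  have close: "\<bar>opt_revenue s - opt_revenue t\<bar> \<le> d"
    using opt_revenue_lipschitz[of s t] d by linarith
  then have d0: "0 \<le> d" by linarith
  have "0 \<le> g" using pos[of undefined] g[of undefined] by linarith
  then have C0: "0 \<le> ?C" by simp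
  have "?m j (opt s $ j) - ?m j (opt t $ j) \<le> ?C * ?w j" for j
  proof -
    have coeff: "\<gamma> $ j * exp (\<gamma> $ j * d) \<le> g * exp (g * d)"
      using pos[of j] g[of j] mult_right_mono[OF g d0, of j] by (intro mult_mono) auto
    have "?m j (opt s $ j) - ?m j (opt t $ j)
        \<le> \<gamma> $ j * exp (\<gamma> $ j * d) * d\<^sup>2 * ?w j"
      using weighted_margin_loss[OF pos[of j] _ close, of "attraction \<alpha> s j" "plo $ j" "phi $ j"]
      unfolding opt_price_eq_clip[OF pos le, symmetric]
      by (simp add: weight_def attraction_def)
    also have "\<dots> \<le> ?C * ?w j"
      using coeff weight_pos[of \<alpha> \<gamma> s j "opt t $ j"] by (intro mult_right_mono) auto
    finally show ?thesis .
  qed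
  then have "(\<Sum>j\<in>UNIV. ?m j (opt s $ j)) - (\<Sum>j\<in>UNIV. ?m j (opt t $ j)) \<le> ?C * ?W"
    by (simp add: sum_subtractf[symmetric] sum_distrib_left sum_mono)
  then have "(opt_revenue s - revenue \<alpha> \<gamma> (opt t) s) * (1 + ?W) \<le> ?C * ?W"
    using revenue_gap[of "opt_revenue s" \<alpha> \<gamma> "opt s" s]
      revenue_gap[of "opt_revenue s" \<alpha> \<gamma> "opt t" s] by simp
  also have "\<dots> \<le> ?C * (1 + ?W)" using C0 by (intro mult_left_mono) auto
  finally show ?thesis
    by (rule mult_right_le_imp_le) (use total_weight_nonneg[of \<alpha> \<gamma> s "opt t"] in linarith)
qed

text \<open>
  The two summands of \<open>3 g d\<^sup>2 + 3 / 2 (g d)\<^sup>2 P\<close> serve two regimes: the first covers the local bound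
  while \<open>exp (g d) \<le> 3\<close>, and the second covers the trivial bound \<open>P\<close> as soon as \<open>g d > 1\<close>.
\<close>

lemma revenue_loss_quadratic:
  assumes g: "\<And>j. \<gamma> $ j \<le> g" and d: "P / 4 * \<bar>s - t\<bar> \<le> d"
  shows "opt_revenue s - revenue \<alpha> \<gamma> (opt t) s \<le> 3 * g * (2 + g * P) / 2 * d\<^sup>2"
proof -
  have g0: "0 < g" using pos[of undefined] g[of undefined] by linarith
  have P0: "0 \<le> P" using lo[of undefined] le[of undefined] hi[of undefined] by linarith
  then have d0: "0 \<le> d" using d mult_nonneg_nonneg[of "P / 4" "\<bar>s - t\<bar>"] by linarith
  have split: "3 * g * (2 + g * P) / 2 * d\<^sup>2 = g * 3 * d\<^sup>2 + 3 / 2 * (g * d)\<^sup>2 * P"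
    by (simp add: power2_eq_square algebra_simps)
  show ?thesis
  proof (cases "g * d \<le> 1")
    case True
    then have "exp (g * d) \<le> 3" using exp_le exp_le_cancel_iff[of "g * d" 1] by linarith
    then have "g * exp (g * d) * d\<^sup>2 \<le> g * 3 * d\<^sup>2"
      using g0 by (intro mult_right_mono mult_left_mono) auto
    moreover have "0 \<le> 3 / 2 * (g * d)\<^sup>2 * P" using P0 by simp
    ultimately show ?thesis using revenue_loss[OF g d] unfolding split by linarith
  next
    case False
    then have "1 \<le> (g * d)\<^sup>2" by (simp add: one_le_power)
    then have "1 * P \<le> 3 / 2 * (g * d)\<^sup>2 * P" using P0 by (intro mult_right_mono) auto
    moreover have "0 \<le> g * 3 * d\<^sup>2" using g0 by simp
    moreover have "opt_revenue s \<le> P" "0 \<le> revenue \<alpha> \<gamma> (opt t) s"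
      using revenue_bounds opt_coordinates by blast+
    ultimately show ?thesis unfolding split by linarith
  qed
qed

end

section \<open>The grid\<close>

lemma nearest_grid_point_distance:
  assumes "2 \<le> M" "s \<in> {lo..hi}" "nearest_index lo hi M s m"
  shows "\<bar>s - grid_point lo hi M m\<bar> \<le> grid_spacing lo hi M / 2"
proof -
  let ?D = "grid_spacing lo hi M"
  have "\<exists>i<M. \<bar>s - grid_point lo hi M i\<bar> \<le> ?D / 2"
  proof (cases "lo = hi")
    case True
    then show ?thesis
      using assms(1,2) by (intro exI[of _ 0]) (auto simp: grid_point_def grid_spacing_def)
  next
    case False
    have M1: "real M - 1 > 0" using assms(1) by simp
    have D: "?D > 0" using False assms(2) M1 by (simp add: grid_spacing_def)
    define y where "y = (s - lo) / ?D"
    have s: "s = lo + y * ?D" using D by (simp add: y_def)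
    have y0: "0 \<le> y" using D assms(2) by (simp add: y_def)
    have "y * ?D \<le> (real M - 1) * ?D"
      using s assms(2) M1 by (simp add: grid_spacing_def)
    then have yM: "y \<le> real M - 1" using D by simp
    \<comment> \<open>In units of the spacing, the closest grid point is a rounding. It cannot exceed \<open>M - 1\<close>, since
      \<open>i \<le> y + 1 / 2 < M\<close> for the position \<open>y \<le> M - 1\<close>.\<close>
    define i where "i = nat (round y)"
    have "round y \<ge> 0" using y0 by (metis round_0 round_mono)
    then have i: "real i = of_int (round y)" by (simp add: i_def)
    have "real i \<le> y + 1 / 2" using of_int_round_le[of y] by (simp add: i)
    then have "i < M" using yM by linarith
    moreover have "\<bar>s - grid_point lo hi M i\<bar> = \<bar>y - real i\<bar> * ?D"
      using D by (simp add: s grid_point_def abs_mult left_diff_distrib[symmetric])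
    moreover have "\<bar>y - real i\<bar> \<le> 1 / 2"
      using of_int_round_abs_le[of y] by (simp add: i abs_minus_commute)
    ultimately show ?thesis using D by (intro exI[of _ i]) (auto simp: mult_right_mono)
  qed
  then show ?thesis
    using assms(3) unfolding nearest_index_def is_arg_min_linorder by fastforce
qed

lemma grid_spacing_bigo: "grid_spacing lo hi \<in> O(\<lambda>M. 1 / real M)"
proof (rule bigoI)
  have "norm (grid_spacing lo hi M) \<le> (2 * \<bar>hi - lo\<bar>) * norm (1 / real M)" if "M \<ge> 2" for M
  proof -
    have "1 / (real M - 1) \<le> 2 / real M" using that by (simp add: field_simps)
    then have "\<bar>hi - lo\<bar> * (1 / (real M - 1)) \<le> \<bar>hi - lo\<bar> * (2 / real M)"
      by (intro mult_left_mono) auto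
    then show ?thesis using that by (simp add: grid_spacing_def abs_divide mult.commute)
  qed
  then show "\<forall>\<^sub>F M in sequentially.
      norm (grid_spacing lo hi M) \<le> (2 * \<bar>hi - lo\<bar>) * norm (1 / real M)"
    unfolding eventually_sequentially by blast
qed

lemma bigo_scale:
  fixes f h :: "nat \<Rightarrow> real"
  shows "f \<in> O(h) \<Longrightarrow> (\<lambda>M. c * f M) \<in> O(h)"
  using landau_o.big.mult[of "\<lambda>_. c" sequentially "\<lambda>_. 1" f h] by simp

theorem proposition5:
  fixes \<alpha> \<gamma> :: "'l \<Rightarrow> real ^ 'j::finite"
    and \<beta> :: "'l \<Rightarrow> real ^ 'd::finite"
    and X :: "(real ^ 'd) set"
    and route :: "real ^ 'd \<Rightarrow> 'l"
    and k :: 'l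
    and plo phi :: "real ^ 'j"
    and gam_lo gam_max p_max s_lo s_hi :: real
    and pstar :: "real \<Rightarrow> real ^ 'j"
    and R :: "real ^ 'j \<Rightarrow> real \<Rightarrow> real"
    and \<Delta> :: "nat \<Rightarrow> real"
  assumes gam_pos: "gam_lo > 0" "\<And>j. \<gamma> k $ j \<ge> gam_lo"
    and bounds: "\<And>j. 0 \<le> plo $ j \<and> plo $ j < phi $ j"
    and domain: "compact X" "routed_to X route k \<noteq> {}"
    and s_lo: "s_lo = index_inf \<beta> X route k"
    and s_hi: "s_hi = index_sup \<beta> X route k"
    and gam_max: "gam_max = (MAX j. \<gamma> k $ j)"
    and p_max: "p_max = (MAX j. phi $ j)"
    and R: "R = revenue (\<alpha> k) (\<gamma> k)"
    and pstar: "pstar = opt_price (\<alpha> k) (\<gamma> k) plo phi"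
    and \<Delta>: "\<Delta> = grid_spacing s_lo s_hi"
  shows
    "(\<forall>M\<ge>2. \<forall>s\<in>{s_lo..s_hi}. \<forall>m. nearest_index s_lo s_hi M s m \<longrightarrow>
        (let ptilde = pstar (grid_point s_lo s_hi M m) in
           infnorm (pstar s - ptilde) \<le> p_max / 8 * \<Delta> M \<and>
           R (pstar s) s - R ptilde s
             \<le> 3 * gam_max * (2 + gam_max * p_max) * p_max\<^sup>2 / 128 * (\<Delta> M)\<^sup>2)) \<and>
     (\<lambda>M. p_max / 8 * \<Delta> M) \<in> O(\<lambda>M. 1 / real M) \<and>
     (\<lambda>M. 3 * gam_max * (2 + gam_max * p_max) * p_max\<^sup>2 / 128 * (\<Delta> M)\<^sup>2)
       \<in> O(\<lambda>M. 1 / (real M)\<^sup>2)"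
proof (intro conjI allI impI ballI)
  have pos: "\<gamma> k $ j > 0" for j using gam_pos(1) gam_pos(2)[of j] by linarith
  have lo: "0 \<le> plo $ j" and le: "plo $ j \<le> phi $ j" for j
    using bounds[of j] by auto
  have hi: "phi $ j \<le> p_max" and g: "\<gamma> k $ j \<le> gam_max" for j
    unfolding p_max gam_max by auto
  have p0: "0 \<le> p_max" using lo[of undefined] le[of undefined] hi[of undefined] by linarith
  fix M :: nat and s :: real and m :: nat
  assume "M \<ge> 2" "s \<in> {s_lo..s_hi}" "nearest_index s_lo s_hi M s m"
  define t where "t = grid_point s_lo s_hi M m"
  have "\<bar>s - t\<bar> \<le> \<Delta> M / 2"
    unfolding t_def \<Delta> by (rule nearest_grid_point_distance) fact+
  then have "p_max / 4 * \<bar>s - t\<bar> \<le> p_max / 4 * (\<Delta> M / 2)"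
    using p0 by (intro mult_left_mono) auto
  then have d: "p_max / 4 * \<bar>s - t\<bar> \<le> p_max / 8 * \<Delta> M" by simp
  have "infnorm (pstar s - pstar t) \<le> p_max / 8 * \<Delta> M"
    using opt_price_lipschitz[OF pos lo le hi, of "\<alpha> k" s t] d unfolding pstar by linarith
  moreover have "R (pstar s) s - R (pstar t) s
      \<le> 3 * gam_max * (2 + gam_max * p_max) / 2 * (p_max / 8 * \<Delta> M)\<^sup>2"
    using revenue_loss_quadratic[OF pos lo le hi g d, of "\<alpha> k"] unfolding pstar R .
  ultimately show "let ptilde = pstar (grid_point s_lo s_hi M m) in
      infnorm (pstar s - ptilde) \<le> p_max / 8 * \<Delta> M \<and>
      R (pstar s) s - R ptilde s
        \<le> 3 * gam_max * (2 + gam_max * p_max) * p_max\<^sup>2 / 128 * (\<Delta> M)\<^sup>2"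
    by (simp add: Let_def t_def power_mult_distrib power_divide)
next
  show "(\<lambda>M. p_max / 8 * \<Delta> M) \<in> O(\<lambda>M. 1 / real M)"
    unfolding \<Delta> by (intro bigo_scale grid_spacing_bigo)
next
  have "(\<lambda>M. (\<Delta> M)\<^sup>2) \<in> O(\<lambda>M. (1 / real M)\<^sup>2)"
    unfolding \<Delta> by (intro landau_o.big_power grid_spacing_bigo)
  then show "(\<lambda>M. 3 * gam_max * (2 + gam_max * p_max) * p_max\<^sup>2 / 128 * (\<Delta> M)\<^sup>2)
      \<in> O(\<lambda>M. 1 / (real M)\<^sup>2)"
    by (intro bigo_scale) (simp add: power_divide)
qed

end
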